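(* Let $X$ be a compact metric space of cardinality greater than $2$ and let $(X,F)$ be a topological dynamical system. If $(X,F)$ has the point-wise specification property, then $h_{se}(X,F)>0$.
   Context: Let $(X,d)$ be a compact metric space and $2^X$ the set of all non-empty subsets of $X$, with $d_H(A,B)=\max\{\sup_{x\in A}\inf_{y\in B}d(x,y),\ \sup_{y\in B}\inf_{x\in A}d(x,y)\}$ for $A,B\in2^X$. A topological dynamical system $(X,F)$ is a set-valued function $F:X\to 2^X$ such that $F(x)$ is a non-empty compact set for each $x\in X$. $F^0$ is the identity ($F^0(x)=\{x\}$) and $F^n(x)=\bigcup_{y\in F^{n-1}(x)}F(y)$ for $n\ge1$. $(X,F)$ has the point-wise specification property if for each $\epsilon>0$ there is $M>0$ such that for any $n\ge1$, any $x^1,\dots,x^n\in X$ and any non-negative integers $a_1<a_2<\dots<a_n$ with $a_{i+1}-a_i>M$, there exists $z\in X$ such that $d_H(F^{a_i}(z),\{x^i\})<\epsilon$ for all $i\in\{1,\dots,n\}$. Separated entropy: for $x\in X$ and $n\in\mathbb{N}$ let $\Sigma_n(x)=\{(x_0,\dots,x_{n-1})\in X^n: x_0=x,\ x_{i+1}\in F(x_i)\text{ for }0\le i<n-1\}$, $D_n(\overline{x},\overline{y})=\max_{0\le i<n}d(x_i,y_i)$, $d_n(x,y)=\inf\{D_n(\overline{x},\overline{y}):\overline{x}\in\Sigma_n(x),\ \overline{y}\in\Sigma_n(y)\}$ and $B_n[x,\epsilon]=\{y\in X: d_n(x,y)\le\epsilon\}$. A set $E\subset X$ is $(d_n,\epsilon)$-separated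 if $B_n[x,\epsilon]\cap E=\{x\}$ for all $x\in E$. Let $S_n(\epsilon)$ be the largest cardinality of a $(d_n,\epsilon)$-separated set. Then $h_{se}(X,F)=\lim_{\epsilon\to0}\limsup_{n\to\infty}\frac1n\log S_n(\epsilon)$. *)

theory Defs
  imports "HOL-Analysis.Analysis"
begin

text \<open>
  A space is a carrier set \<open>X\<close> in a type of class \<open>metric_space\<close>, with the distance \<open>dist\<close>
  of that type; a set-valued function \<open>F : X \<rightarrow> 2\<^sup>X\<close> is a function on the whole type of which
  only the values on \<open>X\<close> matter.
\<close>

definition hausdorff_dist :: "'a::metric_space set \<Rightarrow> 'a set \<Rightarrow> real"
  where "hausdorff_dist A B =
    max (SUP x\<in>A. INF y\<in>B. dist x y) (SUP y\<in>B. INF x\<in>A. dist x y)"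

definition set_valued_system :: "'a::metric_space set \<Rightarrow> ('a \<Rightarrow> 'a set) \<Rightarrow> bool"
  where "set_valued_system X F \<longleftrightarrow> (\<forall>x\<in>X. F x \<subseteq> X \<and> F x \<noteq> {} \<and> compact (F x))"

fun set_iter :: "('a \<Rightarrow> 'a set) \<Rightarrow> nat \<Rightarrow> 'a \<Rightarrow> 'a set"
  where
    "set_iter F 0 x = {x}"
  | "set_iter F (Suc n) x = (\<Union>y\<in>set_iter F n x. F y)"

definition pointwise_specification :: "'a::metric_space set \<Rightarrow> ('a \<Rightarrow> 'a set) \<Rightarrow> bool"
  where "pointwise_specification X F \<longleftrightarrow>
    (\<forall>\<epsilon>::real. \<epsilon> > 0 \<longrightarrow> (\<exists>M::real. M > 0 \<and>
      (\<forall>(n::nat) (x::nat \<Rightarrow> 'a) (a::nat \<Rightarrow> nat).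
        n \<ge> 1 \<and> (\<forall>i\<in>{1..n}. x i \<in> X) \<and> strict_mono_on {1..n} a \<and>
        (\<forall>i. 1 \<le> i \<and> i < n \<longrightarrow> real (a (i + 1)) - real (a i) > M) \<longrightarrow>
        (\<exists>z\<in>X. \<forall>i\<in>{1..n}. hausdorff_dist (set_iter F (a i) z) {x i} < \<epsilon>))))"

text \<open>Tuples \<open>(x\<^sub>0, \<dots>, x\<^bsub>n-1\<^esub>)\<close> are lists of length \<open>n\<close>.\<close>

definition orbit_segments :: "'a set \<Rightarrow> ('a \<Rightarrow> 'a set) \<Rightarrow> nat \<Rightarrow> 'a \<Rightarrow> 'a list set"
  where "orbit_segments X F n x =
    {xs. length xs = n \<and> set xs \<subseteq> X \<and> (0 < n \<longrightarrow> xs ! 0 = x) \<and>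
         (\<forall>i. i + 1 < n \<longrightarrow> xs ! (i + 1) \<in> F (xs ! i))}"

text \<open>The value at \<open>n = 0\<close> (a maximum over the empty set) is meaningless; it has no influence on
  the upper limit that defines the entropy.\<close>

definition segment_dist :: "nat \<Rightarrow> 'a::metric_space list \<Rightarrow> 'a list \<Rightarrow> real"
  where "segment_dist n xs ys = Max ((\<lambda>i. dist (xs ! i) (ys ! i)) ` {0..<n})"

definition orbit_dist ::
    "'a::metric_space set \<Rightarrow> ('a \<Rightarrow> 'a set) \<Rightarrow> nat \<Rightarrow> 'a \<Rightarrow> 'a \<Rightarrow> real"
  where "orbit_dist X F n x y =
    Inf {segment_dist n xs ys | xs ys.
           xs \<in> orbit_segments X F n x \<and> ys \<in> orbit_segments X F n y}"

definition orbit_cball ::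
    "'a::metric_space set \<Rightarrow> ('a \<Rightarrow> 'a set) \<Rightarrow> nat \<Rightarrow> 'a \<Rightarrow> real \<Rightarrow> 'a set"
  where "orbit_cball X F n x \<epsilon> = {y \<in> X. orbit_dist X F n x y \<le> \<epsilon>}"

definition orbit_separated ::
    "'a::metric_space set \<Rightarrow> ('a \<Rightarrow> 'a set) \<Rightarrow> nat \<Rightarrow> real \<Rightarrow> 'a set \<Rightarrow> bool"
  where "orbit_separated X F n \<epsilon> E \<longleftrightarrow>
    E \<subseteq> X \<and> (\<forall>x\<in>E. orbit_cball X F n x \<epsilon> \<inter> E = {x})"

definition ecard :: "'a set \<Rightarrow> enat"
  where "ecard A = (if finite A then enat (card A) else \<infinity>)"

definition elog :: "enat \<Rightarrow> ereal"
  where "elog k =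
    (case k of enat m \<Rightarrow> if m = 0 then -\<infinity> else ereal (ln (real m)) | \<infinity> \<Rightarrow> \<infinity>)"

text \<open>Since \<open>F\<close> is not assumed to be continuous in any sense, separated sets can be infinite, so
  the largest cardinality lives in \<open>enat\<close> and the entropy in \<open>ereal\<close>.\<close>

definition max_separated ::
    "'a::metric_space set \<Rightarrow> ('a \<Rightarrow> 'a set) \<Rightarrow> nat \<Rightarrow> real \<Rightarrow> enat"
  where "max_separated X F n \<epsilon> = (SUP E\<in>{E. orbit_separated X F n \<epsilon> E}. ecard E)"

definition separated_entropy :: "'a::metric_space set \<Rightarrow> ('a \<Rightarrow> 'a set) \<Rightarrow> ereal"
  where "separated_entropy X F =
    Lim (at_right 0)
      (\<lambda>\<epsilon>::real. limsup (\<lambda>n. elog (max_separated X F n \<epsilon>) / ereal (real n)))"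

lemma orbit_segments_nonempty:
  assumes "set_valued_system X F" "x \<in> X"
  shows "orbit_segments X F n x \<noteq> {}"
proof -
  define g where "g = (\<lambda>y. SOME z. z \<in> F y)"
  have g: "g y \<in> F y" "g y \<in> X" if "y \<in> X" for y
    using assms(1) that unfolding set_valued_system_def g_def
    by (metis ex_in_conv someI_ex subsetD)+
  have gX: "(g ^^ i) x \<in> X" for i
    by (induction i) (use assms(2) g in auto)
  have "map (\<lambda>i. (g ^^ i) x) [0..<n] \<in> orbit_segments X F n x"
    unfolding orbit_segments_def using gX g(1) by auto
  then show ?thesis by blast
qed

lemma orbit_dist_self:
  assumes "set_valued_system X F" "x \<in> X" "n \<ge> 1"
  shows "orbit_dist X F n x x \<le> 0"
proof -
  obtain xs where xs: "xs \<in> orbit_segments X F n x"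
    using orbit_segments_nonempty[OF assms(1,2)] by blast
  have nonneg: "segment_dist n ys zs \<ge> 0" for ys zs :: "'a list"
  proof -
    have "0 \<le> dist (ys ! 0) (zs ! 0)" by simp
    also have "\<dots> \<le> segment_dist n ys zs"
      unfolding segment_dist_def using assms(3) by (intro Max_ge) auto
    finally show ?thesis .
  qed
  have "(\<lambda>i. dist (xs ! i) (xs ! i)) ` {0..<n} = {0}"
    using assms(3) by (simp add: image_constant_conv)
  then have "segment_dist n xs xs = 0"
    by (simp add: segment_dist_def)
  moreover have "orbit_dist X F n x x \<le> segment_dist n xs xs"
    unfolding orbit_dist_def
    by (rule cInf_lower) (use xs nonneg in \<open>auto intro!: bdd_belowI[where m = 0]\<close>)
  ultimately show ?thesis by simp
qed

lemma max_separated_antimono: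
  assumes "set_valued_system X F" "n \<ge> 1" "0 \<le> \<epsilon>" "\<epsilon> \<le> \<delta>"
  shows "max_separated X F n \<delta> \<le> max_separated X F n \<epsilon>"
proof -
  have "orbit_separated X F n \<epsilon> E" if E: "orbit_separated X F n \<delta> E" for E
  proof -
    have "E \<subseteq> X" and eq: "\<And>x. x \<in> E \<Longrightarrow> orbit_cball X F n x \<delta> \<inter> E = {x}"
      using E by (auto simp: orbit_separated_def)
    have "orbit_cball X F n x \<epsilon> \<inter> E = {x}" if "x \<in> E" for x
    proof -
      have "orbit_cball X F n x \<epsilon> \<subseteq> orbit_cball X F n x \<delta>"
        using assms(4) by (auto simp: orbit_cball_def)
      moreover have "x \<in> orbit_cball X F n x \<epsilon>"
        using orbit_dist_self[OF assms(1) _ assms(2)] \<open>E \<subseteq> X\<close> that assms(3)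
        by (force simp: orbit_cball_def)
      ultimately show ?thesis using eq[OF that] that by blast
    qed
    then show ?thesis using \<open>E \<subseteq> X\<close> by (simp add: orbit_separated_def)
  qed
  then show ?thesis
    unfolding max_separated_def by (intro SUP_subset_mono) auto
qed

lemma elog_mono: "k \<le> l \<Longrightarrow> elog k \<le> elog l"
  by (auto simp: elog_def split: enat.splits)

text \<open>The limit \<open>\<epsilon> \<rightarrow> 0\<close> in the definition of the entropy exists, so \<open>Lim\<close> is not a
  default value.\<close>

lemma separated_entropy_tendsto:
  assumes "set_valued_system X F"
  shows "((\<lambda>\<epsilon>::real. limsup (\<lambda>n. elog (max_separated X F n \<epsilon>) / ereal (real n)))
           \<longlongrightarrow> separated_entropy X F) (at_right 0)"
proof -
  define f where
    "f = (\<lambda>\<epsilon>::real. limsup (\<lambda>n. elog (max_separated X F n \<epsilon>) / ereal (real n)))"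
  have mono: "f \<delta> \<le> f \<epsilon>" if "0 < \<epsilon>" "\<epsilon> \<le> \<delta>" for \<epsilon> \<delta>
    unfolding f_def
  proof (rule Limsup_mono, rule eventually_sequentiallyI[of 1])
    fix n :: nat assume "1 \<le> n"
    then show "elog (max_separated X F n \<delta>) / ereal (real n)
        \<le> elog (max_separated X F n \<epsilon>) / ereal (real n)"
      using that assms
      by (intro ereal_divide_right_mono elog_mono max_separated_antimono) auto
  qed
  have "(f \<longlongrightarrow> (SUP \<epsilon>\<in>{0<..}. f \<epsilon>)) (at_right 0)"
  proof (rule increasing_tendsto)
    show "\<forall>\<^sub>F \<epsilon> in at_right 0. f \<epsilon> \<le> (SUP \<epsilon>\<in>{0<..}. f \<epsilon>)"
      by (rule eventually_at_rightI[of 0 1]) (auto intro: SUP_upper)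
  next
    fix y assume "y < (SUP \<epsilon>\<in>{0<..}. f \<epsilon>)"
    then obtain \<delta> where "\<delta> > 0" "y < f \<delta>"
      by (auto simp: less_SUP_iff)
    then show "\<forall>\<^sub>F \<epsilon> in at_right 0. y < f \<epsilon>"
      by (intro eventually_at_rightI[of 0 \<delta>]) (auto intro: less_le_trans[OF \<open>y < f \<delta>\<close> mono])
  qed
  moreover from this have "separated_entropy X F = (SUP \<epsilon>\<in>{0<..}. f \<epsilon>)"
    unfolding separated_entropy_def f_def by (rule tendsto_Lim[OF trivial_limit_at_right_real])
  ultimately show ?thesis
    by (simp add: f_def)
qed

end

(* Two distinct points u and v suffice. Let 4 * e = dist u v and let the integer K exceed the gap
   that the specification property needs for e. Every word of length n in u and v is shadowed by
   some z, in the sense that every orbit of z is e-close to the i-th letter at time i * K. Orbits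
   that shadow different words are at distance at least 2 * e at some time i * K, so there are 2^n
   points that are pairwise separated at time n * K + 1, and the entropy is at least
   ln 2 / (K + 1). *)
theory Submission
  imports Defs
begin

lemma set_iter_subset:
  assumes "set_valued_system X F" "z \<in> X"
  shows "set_iter F i z \<subseteq> X"
  using assms by (induction i) (auto simp: set_valued_system_def)

lemma orbit_segments_nth:
  assumes "xs \<in> orbit_segments X F n z" "i < n"
  shows "xs ! i \<in> set_iter F i z"
  using assms(2)
proof (induction i)
  case 0
  then show ?case using assms(1) by (auto simp: orbit_segments_def)
next
  case (Suc i)
  then have "xs ! Suc i \<in> F (xs ! i)" using assms(1) by (auto simp: orbit_segments_def)
  then show ?case using Suc by auto
qed

text \<open>The infimum over \<open>{x}\<close> is \<open>dist y x\<close> itself, so one half of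
  the maximum is a supremum of these distances over \<open>A\<close>. Boundedness of
  \<open>A\<close> ensures that this real supremum is a genuine upper bound.\<close>

lemma dist_le_hausdorff_dist_singleton:
  assumes "bounded A" "y \<in> A"
  shows "dist y x \<le> hausdorff_dist A {x}"
proof -
  have "bdd_above ((\<lambda>y. dist y x) ` A)"
    using assms(1) by (metis bdd_aboveI2 bounded_any_center dist_commute)
  then have "dist y x \<le> (SUP y\<in>A. dist y x)"
    using assms(2) by (intro cSUP_upper)
  then show ?thesis by (simp add: hausdorff_dist_def)
qed

text \<open>Each orbit segment meets the \<open>i\<close>-th iterate of its starting point at time
  \<open>i\<close>, and \<open>segment_dist\<close> dominates the distance at every single time. One
  time at which the iterates are far apart thus controls all pairs of segments at once.\<close>

lemma le_orbit_dist:
  assumes sys: "set_valued_system X F" and "x \<in> X" "y \<in> X" and "i < n"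
    and le: "\<And>p q. p \<in> set_iter F i x \<Longrightarrow> q \<in> set_iter F i y \<Longrightarrow> c \<le> dist p q"
  shows "c \<le> orbit_dist X F n x y"
  unfolding orbit_dist_def
proof (rule cInf_greatest)
  show "{segment_dist n xs ys | xs ys.
      xs \<in> orbit_segments X F n x \<and> ys \<in> orbit_segments X F n y} \<noteq> {}"
    using orbit_segments_nonempty[OF sys \<open>x \<in> X\<close>] orbit_segments_nonempty[OF sys \<open>y \<in> X\<close>]
    by blast
next
  fix s assume "s \<in> {segment_dist n xs ys | xs ys.
      xs \<in> orbit_segments X F n x \<and> ys \<in> orbit_segments X F n y}"
  then obtain xs ys where s: "s = segment_dist n xs ys"
    and "xs \<in> orbit_segments X F n x" "ys \<in> orbit_segments X F n y"
    by blast
  then have "c \<le> dist (xs ! i) (ys ! i)"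
    using \<open>i < n\<close> by (intro le orbit_segments_nth)
  also have "\<dots> \<le> s"
    unfolding s segment_dist_def using \<open>i < n\<close> by (intro Max_ge) auto
  finally show "c \<le> s" .
qed

text \<open>Indexing by \<open>W\<close> loses no points: if \<open>z\<close> agreed on two indices,
  a point would be more than \<delta> away from itself, against \<open>orbit_dist_self\<close> and 0
  \<le> \<delta>.\<close>

lemma separated_family_bound:
  assumes sys: "set_valued_system X F" and "n \<ge> 1" "0 \<le> \<delta>" "finite W"
    and X: "\<And>w. w \<in> W \<Longrightarrow> z w \<in> X"
    and far: "\<And>w w'. w \<in> W \<Longrightarrow> w' \<in> W \<Longrightarrow> w \<noteq> w' \<Longrightarrow> \<delta> < orbit_dist X F n (z w) (z w')"
  shows "enat (card W) \<le> max_separated X F n \<delta>"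
proof -
  have self: "orbit_dist X F n (z w) (z w) \<le> \<delta>" if "w \<in> W" for w
    using orbit_dist_self[OF sys X[OF that] \<open>n \<ge> 1\<close>] \<open>0 \<le> \<delta>\<close> by linarith
  have inj: "inj_on z W"
  proof (rule inj_onI, rule ccontr)
    fix w w' assume "w \<in> W" "w' \<in> W" "z w = z w'" "w \<noteq> w'"
    then show False using far[of w w'] self[of w] by simp
  qed
  have "orbit_cball X F n (z w) \<delta> \<inter> z ` W = {z w}" if "w \<in> W" for w
    using that X self far by (fastforce simp: orbit_cball_def)
  then have "orbit_separated X F n \<delta> (z ` W)"
    using X by (auto simp: orbit_separated_def)
  then have "ecard (z ` W) \<le> max_separated X F n \<delta>"
    unfolding max_separated_def by (intro SUP_upper) simp
  then show ?thesis using \<open>finite W\<close> inj by (simp add: ecard_def card_image)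
qed

text \<open>The gap depends on \<open>e\<close> alone, so \<open>K\<close> is fixed before
  \<open>n\<close> and \<delta>. This uniformity yields a growth rate that survives both limits in
  the entropy.\<close>

lemma specification_max_separated:
  assumes "compact X" and sys: "set_valued_system X F" and "pointwise_specification X F"
    and uv: "u \<in> X" "v \<in> X" and e: "0 < e" "4 * e \<le> dist u v"
  shows "\<exists>K>0. \<forall>n\<ge>1. \<forall>\<delta>\<in>{0..e}. enat (2 ^ n) \<le> max_separated X F (n * K + 1) \<delta>"
proof -
  obtain M :: real where "M > 0" and M: "\<And>(n::nat) (x::nat \<Rightarrow> 'a) (a::nat \<Rightarrow> nat).
        n \<ge> 1 \<and> (\<forall>i\<in>{1..n}. x i \<in> X) \<and> strict_mono_on {1..n} a \<and>
        (\<forall>i. 1 \<le> i \<and> i < n \<longrightarrow> real (a (i + 1)) - real (a i) > M) \<Longrightarrow>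
        (\<exists>z\<in>X. \<forall>i\<in>{1..n}. hausdorff_dist (set_iter F (a i) z) {x i} < e)"
    using assms(3) e unfolding pointwise_specification_def by metis
  obtain K :: nat where "M < real K" using reals_Archimedean2 by blast
  with \<open>M > 0\<close> have "K > 0" by (cases K) auto
  have "enat (2 ^ n) \<le> max_separated X F (n * K + 1) \<delta>"
    if "n \<ge> 1" "\<delta> \<in> {0..e}" for n \<delta>
  proof -
    \<comment> \<open>Extensional functions make the words a finite set and force distinct words to
      differ at an index in \<open>{1..n}\<close>.\<close>
    define W where "W = {1..n} \<rightarrow>\<^sub>E {u, v}"
    have "u \<noteq> v" using e by auto
    have "finite W" by (simp add: W_def finite_PiE)
    have "card {u, v} = 2" using \<open>u \<noteq> v\<close> by simp
    then have card: "card W = 2 ^ n"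
      by (simp only: W_def card_PiE[OF finite_atLeastAtMost] prod_constant card_atLeastAtMost
          diff_Suc_1)
    have "\<exists>z\<in>X. \<forall>i\<in>{1..n}. hausdorff_dist (set_iter F (i * K) z) {w i} < e" if "w \<in> W" for w
    proof (rule M, intro conjI ballI allI impI)
      show "n \<ge> 1" by fact
      show "w i \<in> X" if "i \<in> {1..n}" for i
        using \<open>w \<in> W\<close> that uv by (auto simp: W_def PiE_iff)
      show "strict_mono_on {1..n} (\<lambda>i. i * K)"
        using \<open>K > 0\<close> by (auto simp: strict_mono_on_def)
      show "real ((i + 1) * K) - real (i * K) > M" for i
        using \<open>M < real K\<close> by (simp add: algebra_simps)
    qed
    then obtain z where zX: "\<And>w. w \<in> W \<Longrightarrow> z w \<in> X"
      and z: "\<And>w i. w \<in> W \<Longrightarrow> i \<in> {1..n} \<Longrightarrow>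
        hausdorff_dist (set_iter F (i * K) (z w)) {w i} < e"
      by metis
    have shadow: "dist p (w i) < e"
      if "w \<in> W" "i \<in> {1..n}" "p \<in> set_iter F (i * K) (z w)" for w i p
    proof -
      \<comment> \<open>Compactness of \<open>X\<close> enters as boundedness, since the iterates
        stay in \<open>X\<close>.\<close>
      have "bounded (set_iter F (i * K) (z w))"
        using set_iter_subset[OF sys zX] compact_imp_bounded[OF \<open>compact X\<close>] that(1)
        by (metis bounded_subset)
      then show ?thesis
        using dist_le_hausdorff_dist_singleton[OF _ that(3), of "w i"] z[OF that(1,2)] by linarith
    qed
    have "\<delta> < orbit_dist X F (n * K + 1) (z w) (z w')"
      if w: "w \<in> W" "w' \<in> W" and "w \<noteq> w'" for w w'
    proof -
      obtain i where i: "i \<in> {1..n}" and "w i \<noteq> w' i"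
        using PiE_ext[OF w[unfolded W_def]] \<open>w \<noteq> w'\<close> by blast
      moreover have "w i \<in> {u, v}" "w' i \<in> {u, v}"
        using w i by (auto simp: W_def PiE_iff)
      ultimately have far: "4 * e \<le> dist (w i) (w' i)"
        using e by (auto simp: dist_commute)
      \<comment> \<open>The letters are \<open>4 * e\<close> apart, and each shadowing point costs
        less than \<open>e\<close>.\<close>
      have "2 * e \<le> dist p q"
        if "p \<in> set_iter F (i * K) (z w)" "q \<in> set_iter F (i * K) (z w')" for p q
      proof -
        have "dist (w i) (w' i) \<le> dist p (w i) + dist p q + dist q (w' i)" by metric
        then show ?thesis using shadow[OF w(1) i that(1)] shadow[OF w(2) i that(2)] far by linarith
      qed
      \<comment> \<open>The last shadowing time is \<open>n * K\<close>; the extra 1 in the length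
        makes it an index of the segment.\<close>
      moreover have "i * K < n * K + 1" using i by (simp add: less_Suc_eq_le)
      ultimately have "2 * e \<le> orbit_dist X F (n * K + 1) (z w) (z w')"
        using le_orbit_dist[OF sys zX zX] w by blast
      then show ?thesis using \<open>\<delta> \<in> {0..e}\<close> e by auto
    qed
    then have "enat (card W) \<le> max_separated X F (n * K + 1) \<delta>"
      using \<open>\<delta> \<in> {0..e}\<close> \<open>finite W\<close> zX by (intro separated_family_bound[OF sys]) auto
    then show ?thesis by (simp add: card)
  qed
  then show ?thesis using \<open>K > 0\<close> by blast
qed

text \<open>The hypothesis speaks only of the lengths \<open>n * K + 1\<close>, which is enough
  because an upper limit dominates the one along a subsequence.\<close>

lemma limsup_growth_bound:
  assumes "K > 0" and le: "\<And>n. n \<ge> 1 \<Longrightarrow> enat (2 ^ n) \<le> S (n * K + 1)"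
  shows "ereal (ln 2 / (real K + 1)) \<le> limsup (\<lambda>n. elog (S n) / ereal (real n))"
proof -
  \<comment> \<open>The shift to \<open>Suc n\<close> keeps to words of length at least 1;
    \<open>K > 0\<close> makes \<open>r\<close> strictly increasing.\<close>
  define r where "r = (\<lambda>n. Suc n * K + 1)"
  have "ereal (ln 2 / (real K + 1)) \<le> elog (S (r n)) / ereal (real (r n))" for n
  proof -
    have pos: "0 < real (r n)" by (simp only: r_def of_nat_0_less_iff)
    \<comment> \<open>Absorbing the final 1 into \<open>Suc n\<close> replaces the length by a
      multiple of the word length, so the quotient has a bound free of \<open>n\<close>.\<close>
    have "real (r n) \<le> real (Suc n) * (real K + 1)"
      by (simp add: r_def algebra_simps)
    then have "ln 2 * real (r n) \<le> ln 2 * (real (Suc n) * (real K + 1))"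
      by (intro mult_left_mono) auto
    then have "ln 2 / (real K + 1) \<le> real (Suc n) * ln 2 / real (r n)"
      using pos by (simp add: divide_simps mult_ac)
    then have "ereal (ln 2 / (real K + 1)) \<le> ereal (real (Suc n) * ln 2) / ereal (real (r n))"
      using pos by simp
    also have "ereal (real (Suc n) * ln 2) = elog (enat (2 ^ Suc n))"
      by (simp add: elog_def ln_realpow ln_mult algebra_simps)
    also have "elog (enat (2 ^ Suc n)) / ereal (real (r n)) \<le> elog (S (r n)) / ereal (real (r n))"
      using pos unfolding r_def by (intro ereal_divide_right_mono elog_mono le) simp_all
    finally show ?thesis .
  qed
  then have "ereal (ln 2 / (real K + 1)) \<le> limsup ((\<lambda>n. elog (S n) / ereal (real n)) \<circ> r)"
    by (intro le_Limsup) auto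
  also have "\<dots> \<le> limsup (\<lambda>n. elog (S n) / ereal (real n))"
    using \<open>K > 0\<close> by (intro limsup_subseq_mono) (auto simp: r_def strict_mono_def)
  finally show ?thesis .
qed

theorem theorem5p10:
  fixes X :: "'a::metric_space set" and F :: "'a \<Rightarrow> 'a set"
  assumes "compact X"
    and "ecard X > 2"
    and "set_valued_system X F"
    and "pointwise_specification X F"
  shows "separated_entropy X F > 0"
proof -
  obtain u v where uv: "u \<in> X" "v \<in> X" "u \<noteq> v"
  proof (rule ccontr)
    assume "\<not> thesis"
    then have "\<forall>u\<in>X. \<forall>v\<in>X. u = v" using that by blast
    then have "X = {} \<or> (\<exists>u. X = {u})" by blast
    with assms(2) show False by (auto simp: ecard_def numeral_eq_enat)
  qed
  define e where "e = dist u v / 4"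
  have e: "0 < e" "4 * e \<le> dist u v" using uv by (auto simp: e_def)
  obtain K where "K > 0"
    and K: "\<And>n \<delta>. n \<ge> 1 \<Longrightarrow> \<delta> \<in> {0..e} \<Longrightarrow> enat (2 ^ n) \<le> max_separated X F (n * K + 1) \<delta>"
    using specification_max_separated[OF assms(1,3,4) uv(1,2) e] by blast
  have "ereal (ln 2 / (real K + 1)) \<le> limsup (\<lambda>n. elog (max_separated X F n \<delta>) / ereal (real n))"
    if "\<delta> \<in> {0<..<e}" for \<delta>
  proof (rule limsup_growth_bound[OF \<open>K > 0\<close>])
    show "enat (2 ^ n) \<le> max_separated X F (n * K + 1) \<delta>" if "n \<ge> 1" for n
      using \<open>\<delta> \<in> {0<..<e}\<close> that by (intro K) auto
  qed
  then have "\<forall>\<^sub>F \<delta> in at_right 0.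
      ereal (ln 2 / (real K + 1)) \<le> limsup (\<lambda>n. elog (max_separated X F n \<delta>) / ereal (real n))"
    by (rule eventually_at_rightI[OF _ e(1)])
  \<comment> \<open>The bound is the same for all small \<delta>, and
    \<open>separated_entropy_tendsto\<close> makes the entropy a true limit, so the bound passes to
    it.\<close>
  then have "ereal (ln 2 / (real K + 1)) \<le> separated_entropy X F"
    by (intro tendsto_lowerbound[OF separated_entropy_tendsto[OF assms(3)]]) auto
  moreover have "0 < ereal (ln 2 / (real K + 1))" by simp
  ultimately show ?thesis by (rule less_le_trans[rotated])
qed

end
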